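(* Let $k\in\mathbb{N}$, $0<\tau\le 1$, $0<\mu\le 1$, $0\le\tau-\mu<1$, $0\le\delta<1$, $0\le\gamma<1$, $\tau-\mu+\gamma<1$, and let $0\le\alpha<1$. If $f\in\mathcal{P}_{\tau,\mu}(k,\delta,\gamma)$, then $f$ is starlike of order $\alpha$ in the disk $|z|<r_1$, i.e. $\Re\big(zf'(z)/f(z)\big)>\alpha$ for all $|z|<r_1$, where $$r_1:=\inf_{\nu\ge k+1}\left\{\frac{(1-\alpha)(1+\delta\nu-\delta)\,\Gamma(\nu+\tau)\Gamma(\mu+1)}{(\nu-\alpha)(1-\gamma)\,\Gamma(\nu+\mu)\Gamma(\tau+1)}\right\}^{1/(\nu-1)},$$ the infimum being over integers $\nu\ge k+1$.
   Context: $\mathbb{U}=\{z\in\mathbb{C}:|z|<1\}$, $\mathbb{N}=\{1,2,3,\dots\}$. For $k\in\mathbb{N}$, $\mathcal{P}(k)$ is the class of functions that are analytic and univalent in $\mathbb{U}$ and of the form $f(z)=z-\sum_{\nu=k+1}^{\infty}a_\nu z^\nu$ with all $a_\nu\ge 0$. The quotient $zf'(z)/f(z)$ is assigned its limit value $1$ at $z=0$. Srivastava-Owa fractional derivative: for $0\le\varsigma<1$, $\mathfrak{D}_z^{\varsigma}g(z)=\frac{1}{\Gamma(1-\varsigma)}\frac{d}{dz}\int_0^z g(\zeta)(z-\zeta)^{-\varsigma}\,d\zeta$, where the multiplicity of $(z-\zeta)^{-\varsigma}$ is removed by requiring $\log(z-\zeta)$ to be real when $z-\zeta>0$. Tremblay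 operator: for $0<\tau\le 1$, $0<\mu\le 1$, $0\le\tau-\mu<1$, $\mathfrak{T}^{\tau,\mu}f(z)=\frac{\Gamma(\mu)}{\Gamma(\tau)}z^{1-\mu}\,\mathfrak{D}_z^{\tau-\mu}\big[z^{\tau-1}f(z)\big]$ for $z\in\mathbb{U}$. (Powers of $z$ and $\zeta$ are taken with the principal branch and the integral along the segment from $0$ to $z$; the resulting function is understood as extended analytically to all of $\mathbb{U}$, including $z=0$ and the negative real axis.) Class $\mathcal{P}_{\tau,\mu}(k,\delta,\gamma)$ (with $0<\tau\le1$, $0<\mu\le1$, $0\le\tau-\mu<1$, $0\le\delta<1$, $0\le\gamma<1$, $\tau-\mu+\gamma<1$): the set of $f\in\mathcal{P}(k)$ such that for all $z\in\mathbb{U}$ $$\Re\left(\frac{\Gamma(\mu+1)\Gamma(\tau)}{\Gamma(\tau+1)\Gamma(\mu)}z^{-1}\left[(1-\delta)\mathfrak{T}^{\tau,\mu}f(z)+\delta z\big(\mathfrak{T}^{\tau,\mu}f\big)'(z)\right]\right)>\gamma,$$ the value at $z=0$ being understood by removing the singularity. *)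

theory Defs
  imports "HOL-Complex_Analysis.Complex_Analysis"
begin

text \<open>Functions on the unit disk are rendered as total functions \<^typ>\<open>complex \<Rightarrow> complex\<close>
  of which only the values on \<^term>\<open>ball (0::complex) 1\<close> matter.\<close>

definition class_P :: "nat \<Rightarrow> (complex \<Rightarrow> complex) set" where
  "class_P k = {f. f holomorphic_on ball 0 1 \<and> inj_on f (ball 0 1) \<and>
     (\<exists>a :: nat \<Rightarrow> real. (\<forall>\<nu>\<ge>k+1. a \<nu> \<ge> 0) \<and>
        (\<forall>z\<in>ball 0 1. summable (\<lambda>n. of_real (a (n + (k+1))) * z ^ (n + (k+1))) \<and>
            f z = z - (\<Sum>n. of_real (a (n + (k+1))) * z ^ (n + (k+1)))))}"

text \<open>Srivastava--Owa fractional derivative.  The contour integral is a gauge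
  (Henstock--Kurzweil) integral, so the integrable singularities at both ends of the segment
  need no separate limiting process.  \<open>powr\<close> uses the principal branch, for which
  \<open>log (z - \<zeta>)\<close> is real when \<open>z - \<zeta> > 0\<close>.\<close>

definition frac_deriv :: "real \<Rightarrow> (complex \<Rightarrow> complex) \<Rightarrow> complex \<Rightarrow> complex" where
  "frac_deriv \<sigma> g z =
     1 / of_real (Gamma (1 - \<sigma>)) *
     deriv (\<lambda>w. contour_integral (linepath 0 w)
                  (\<lambda>\<zeta>. g \<zeta> * (w - \<zeta>) powr (- of_real \<sigma>))) z"

text \<open>The Tremblay formula with principal powers; it is meaningful off the branch cut
  \<^term>\<open>\<real>\<^sub>\<le>\<^sub>0 :: complex set\<close>.\<close>

definition tremblay_formula :: "real \<Rightarrow> real \<Rightarrow> (complex \<Rightarrow> complex) \<Rightarrow> complex \<Rightarrow> complex" where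
  "tremblay_formula \<tau> \<mu> f z =
     of_real (Gamma \<mu> / Gamma \<tau>) * z powr (1 - of_real \<mu>) *
     frac_deriv (\<tau> - \<mu>) (\<lambda>\<zeta>. \<zeta> powr (of_real \<tau> - 1) * f \<zeta>) z"

text \<open>The operator itself is the analytic extension of the formula from the slit disk to the
  whole disk.  By the identity theorem its values on the disk do not depend on the choice;
  outside the disk they are unspecified.\<close>

definition tremblay :: "real \<Rightarrow> real \<Rightarrow> (complex \<Rightarrow> complex) \<Rightarrow> complex \<Rightarrow> complex" where
  "tremblay \<tau> \<mu> f =
     (SOME F. F holomorphic_on ball 0 1 \<and>
        (\<forall>z\<in>ball 0 1 - \<real>\<^sub>\<le>\<^sub>0. F z = tremblay_formula \<tau> \<mu> f z))"

text \<open>\<^const>\<open>remove_sings\<close> replaces the value at \<open>z = 0\<close> (where the quotient is a junk value)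
  by the limit; at all other points of the disk it changes nothing.\<close>

definition class_P_tremblay ::
    "real \<Rightarrow> real \<Rightarrow> nat \<Rightarrow> real \<Rightarrow> real \<Rightarrow> (complex \<Rightarrow> complex) set" where
  "class_P_tremblay \<tau> \<mu> k \<delta> \<gamma> = {f \<in> class_P k. \<forall>z\<in>ball 0 1.
     Re (remove_sings
          (\<lambda>w. of_real (Gamma (\<mu> + 1) * Gamma \<tau> / (Gamma (\<tau> + 1) * Gamma \<mu>)) * inverse w *
               (of_real (1 - \<delta>) * tremblay \<tau> \<mu> f w
                + of_real \<delta> * w * deriv (tremblay \<tau> \<mu> f) w)) z) > \<gamma>}"

definition starlike_of_order_in_disk :: "real \<Rightarrow> real \<Rightarrow> (complex \<Rightarrow> complex) \<Rightarrow> bool" where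
  "starlike_of_order_in_disk \<alpha> r f \<longleftrightarrow>
     (\<forall>z. norm z < r \<longrightarrow> Re (if z = 0 then 1 else z * deriv f z / f z) > \<alpha>)"

definition starlike_radius ::
    "nat \<Rightarrow> real \<Rightarrow> real \<Rightarrow> real \<Rightarrow> real \<Rightarrow> real \<Rightarrow> real" where
  "starlike_radius k \<tau> \<mu> \<delta> \<gamma> \<alpha> =
     (INF \<nu>\<in>{k+1..}.
        ((1 - \<alpha>) * (1 + \<delta> * real \<nu> - \<delta>) * Gamma (real \<nu> + \<tau>) * Gamma (\<mu> + 1) /
         ((real \<nu> - \<alpha>) * (1 - \<gamma>) * Gamma (real \<nu> + \<mu>) * Gamma (\<tau> + 1)))
        powr (1 / (real \<nu> - 1)))"

end

theory Submission
  imports Defs "HOL-Real_Asymp.Real_Asymp"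
begin

text \<open>
  Termwise Beta integrals show that the Tremblay operator multiplies the \<open>n\<close>-th Taylor
  coefficient by \<open>\<Gamma>(\<mu>) \<Gamma>(n + \<tau>) / (\<Gamma>(\<tau>) \<Gamma>(n + \<mu>))\<close>.  Evaluating the class condition at
  \<open>z = r\<close> and letting \<open>r \<rightarrow> 1\<close> from below bounds the weighted sum of the \<open>a\<^sub>n\<close> by
  \<open>1 - \<gamma>\<close>.  The radius is chosen so that this bound dominates the series controlling
  \<open>|z f'(z) - f(z)| < (1 - \<alpha>) |f(z)|\<close>; it is at most \<open>1\<close> because the quantities under the
  root grow only polynomially in \<open>\<nu>\<close>.
\<close>

section \<open>Power series on the unit disk\<close>

lemma powser_abs_summable:
  fixes c :: "nat \<Rightarrow> complex"
  assumes "\<And>z. norm z < 1 \<Longrightarrow> summable (\<lambda>n. c n * z ^ n)" and "norm w < 1"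
  shows "summable (\<lambda>n. norm (c n * w ^ n))"
proof (rule powser_insidea)
  \<comment> \<open>The midpoint of |w| and 1 is a radius strictly between them; convergence at that
    point forces absolute convergence at \<open>w\<close>.\<close>
  have r: "norm w < (norm w + 1) / 2" "(norm w + 1) / 2 < 1" "(norm w + 1) / 2 \<ge> 0"
    using assms(2) by (auto simp: add_nonneg_nonneg)
  have *: "norm (complex_of_real ((norm w + 1) / 2)) = (norm w + 1) / 2"
    unfolding norm_of_real using r by simp
  show "summable (\<lambda>n. c n * of_real ((norm w + 1) / 2) ^ n)"
    by (rule assms(1)) (use * r in linarith)
  show "norm w < norm (complex_of_real ((norm w + 1) / 2))"
    using * r by linarith
qed

text \<open>The second claim concerns the Euler operator z g'(z), which multiplies the n-th
  coefficient by n and keeps the exponent, so that series can later be combined termwise.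
  \<open>g\<close> is known only inside the disk, hence the derivative of the series is transferred
  by equality near \<open>z\<close>.\<close>

lemma powser_has_field_derivative:
  fixes c :: "nat \<Rightarrow> complex"
  assumes sums: "\<And>z. norm z < 1 \<Longrightarrow> (\<lambda>n. c n * z ^ n) sums g z" and z: "norm z < 1"
  shows "(g has_field_derivative deriv g z) (at z)"
    and "(\<lambda>n. of_nat n * c n * z ^ n) sums (z * deriv g z)"
proof -
  have sm: "summable (\<lambda>n. c n * z ^ n)" if "norm z < 1" for z
    using sums[OF that] by (rule sums_summable)
  have "((\<lambda>z. \<Sum>n. c n * z ^ n) has_field_derivative (\<Sum>n. diffs c n * z ^ n)) (at z)"
    by (rule termdiffs_strong'[OF sm z])
  moreover have "eventually (\<lambda>w. (\<Sum>n. c n * w ^ n) = g w) (nhds z)"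
    using eventually_nhds_in_open[of "ball 0 1" z] z
    by (auto elim!: eventually_mono intro!: sums_unique[symmetric] sums)
  ultimately have D: "(g has_field_derivative (\<Sum>n. diffs c n * z ^ n)) (at z)"
    by (subst (asm) DERIV_cong_ev[OF refl _ refl])
  then have deriv_eq: "deriv g z = (\<Sum>n. diffs c n * z ^ n)"
    by (rule DERIV_imp_deriv)
  show "(g has_field_derivative deriv g z) (at z)"
    using D deriv_eq by simp
  have "(\<lambda>n. of_nat n * c n * z ^ (n - Suc 0)) sums deriv g z"
    unfolding deriv_eq by (rule diffs_equiv[OF termdiff_converges[OF z sm]])
  from sums_mult[OF this, of z]
  show "(\<lambda>n. of_nat n * c n * z ^ n) sums (z * deriv g z)"
  proof (rule back_subst[of "\<lambda>h. h sums _"])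
    \<comment> \<open>At \<open>n = 0\<close> the truncated exponent \<open>n - Suc 0\<close> does
      no harm, since the factor \<open>of_nat n\<close> vanishes.\<close>
    show "(\<lambda>n. z * (of_nat n * c n * z ^ (n - Suc 0))) = (\<lambda>n. of_nat n * c n * z ^ n)"
    proof
      fix n show "z * (of_nat n * c n * z ^ (n - Suc 0)) = of_nat n * c n * z ^ n"
        by (cases n) simp_all
    qed
  qed
qed

lemma powser_holomorphic:
  fixes c :: "nat \<Rightarrow> complex"
  assumes "\<And>z. norm z < 1 \<Longrightarrow> (\<lambda>n. c n * z ^ n) sums g z"
  shows "g holomorphic_on ball 0 1"
  by (rule power_series_holomorphic[where a = c]) (use assms in simp)

section \<open>Beta integrals of power series\<close>

lemma Beta_nonneg: "0 < p \<Longrightarrow> 0 < q \<Longrightarrow> 0 \<le> Beta p (q :: real)"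
  by (simp add: Beta_def Gamma_real_pos less_imp_le add_pos_pos)

text \<open>The recurrence (x + q) B(x + 1, q) = x B(x, q) has a factor x / (x + q) below 1. The
  bound serves twice: to dominate Beta-weighted power series, and to control the growth of Gamma
  quotients.\<close>

lemma Beta_add_nat_le:
  fixes p q :: real
  assumes "0 < p" "0 < q"
  shows "Beta (p + real n) q \<le> Beta p q"
proof (induction n)
  case (Suc n)
  let ?x = "p + real n"
  have x: "?x > 0" using assms by simp
  then have "?x \<notin> \<int>\<^sub>\<le>\<^sub>0" by (auto elim!: nonpos_Ints_cases)
  then have "(?x + q) * Beta (?x + 1) q = ?x * Beta ?x q" by (rule Beta_plus1_left)
  also have "\<dots> \<le> (?x + q) * Beta ?x q"
    using assms x by (intro mult_right_mono Beta_nonneg) auto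
  finally have "Beta (?x + 1) q \<le> Beta ?x q" using x assms by simp
  then show ?case using Suc by (simp add: add_ac)
qed simp

lemma summable_Beta_powser:
  fixes c :: "nat \<Rightarrow> complex" and p q :: real
  assumes sm: "\<And>z. norm z < 1 \<Longrightarrow> summable (\<lambda>n. c n * z ^ n)"
    and w: "norm w < 1" and "0 < p" "0 < q"
  shows "summable (\<lambda>n. c n * of_real (Beta (p + real n) q) * w ^ n)"
proof (rule summable_comparison_test')
  show "summable (\<lambda>n. Beta p q * norm (c n * w ^ n))"
    by (intro summable_mult powser_abs_summable[OF sm w])
  fix n
  have "Beta (p + real n) q * norm (c n * w ^ n) \<le> Beta p q * norm (c n * w ^ n)"
    using assms by (intro mult_right_mono Beta_add_nat_le) auto
  moreover have "Beta (p + real n) q \<ge> 0"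
    using assms by (intro Beta_nonneg) auto
  ultimately show "norm (c n * of_real (Beta (p + real n) q) * w ^ n) \<le> Beta p q * norm (c n * w ^ n)"
    by (simp add: norm_mult algebra_simps)
qed

text \<open>Each monomial t^n moves the first Beta parameter from p to p + n. Sum and integral are
  exchanged by dominated convergence: on [0, 1] the partial sums are at most the Beta kernel
  \<open>K t\<close> times \<open>M\<close>, the sum of the |c_n w^n|.\<close>

lemma has_integral_Beta_powser:
  fixes c :: "nat \<Rightarrow> complex" and p q :: real
  assumes sums: "\<And>z. norm z < 1 \<Longrightarrow> (\<lambda>n. c n * z ^ n) sums f z"
    and w: "norm w < 1" and p: "0 < p" and q: "0 < q"
  shows "((\<lambda>t. of_real (t powr (p - 1) * (1 - t) powr (q - 1)) * f (of_real t * w)) has_integral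
           (\<Sum>n. c n * of_real (Beta (p + real n) q) * w ^ n)) {0..1}"
proof -
  have sm: "summable (\<lambda>n. c n * z ^ n)" if "norm z < 1" for z
    using sums[OF that] by (rule sums_summable)
  define K where "K t = t powr (p - 1) * (1 - t) powr (q - 1)" for t
  have K: "K t \<ge> 0" for t by (simp add: K_def)
  have abs: "summable (\<lambda>n. norm (c n * w ^ n))"
    by (rule powser_abs_summable[OF sm w])
  define M where "M = (\<Sum>n. norm (c n * w ^ n))"
  have term_int: "((\<lambda>t. of_real (K t) * (c n * (of_real t * w) ^ n)) has_integral
                    c n * of_real (Beta (p + real n) q) * w ^ n) {0..1}" for n
  proof -
    have "((\<lambda>t. t powr (p + real n - 1) * (1 - t) powr (q - 1)) has_integral
            Beta (p + real n) q) {0..1}"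
      using p q by (intro has_integral_Beta_real) auto
    then have "((\<lambda>t. of_real (t powr (p + real n - 1) * (1 - t) powr (q - 1))) has_integral
            complex_of_real (Beta (p + real n) q)) {0..1}"
      by (rule has_integral_of_real)
    then have "((\<lambda>t. (c n * w ^ n) * of_real (t powr (p + real n - 1) * (1 - t) powr (q - 1)))
            has_integral (c n * w ^ n) * complex_of_real (Beta (p + real n) q)) {0..1}"
      by (rule has_integral_mult_right)
    then have "((\<lambda>t. of_real (K t) * (c n * (of_real t * w) ^ n)) has_integral
            (c n * w ^ n) * complex_of_real (Beta (p + real n) q)) {0..1}"
    proof (rule has_integral_eq[rotated])
      fix t :: real assume t: "t \<in> {0..1}"
      have "t powr (p + real n - 1) = t powr (p - 1) * t ^ n"
      \<comment> \<open>At \<open>t = 0\<close> both sides vanish because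
        \<open>0 powr x = 0\<close> for every exponent, even when \<open>n = 0\<close> and
        \<open>t ^ n = 1\<close>.\<close>
      proof (cases "t = 0")
        case False
        then have "t > 0" using t by simp
        moreover have "p + real n - 1 = (p - 1) + real n" by simp
        ultimately show ?thesis by (simp only: powr_add powr_realpow)
      qed simp
      then show "c n * w ^ n * of_real (t powr (p + real n - 1) * (1 - t) powr (q - 1)) =
          of_real (K t) * (c n * (of_real t * w) ^ n)"
        by (simp add: K_def power_mult_distrib)
    qed
    then show ?thesis by (simp add: mult_ac)
  qed
  have "((\<lambda>t. of_real (K t) * f (of_real t * w)) has_integral
           (\<Sum>n. c n * of_real (Beta (p + real n) q) * w ^ n)) {0..1}"
  proof (rule has_integral_dominated_convergence)
    show "((\<lambda>t. \<Sum>n<N. of_real (K t) * (c n * (of_real t * w) ^ n)) has_integral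
            (\<Sum>n<N. c n * of_real (Beta (p + real n) q) * w ^ n)) {0..1}" for N
      by (intro has_integral_sum term_int) auto
    show "(\<lambda>t. K t * M) integrable_on {0..1}"
      unfolding K_def
      using has_integral_mult_left[OF has_integral_Beta_real[OF p q]] by (auto simp: integrable_on_def)
    show "\<forall>t\<in>{0..1}. norm (\<Sum>n<N. of_real (K t) * (c n * (of_real t * w) ^ n)) \<le> K t * M" for N
    proof
      fix t :: real assume t: "t \<in> {0..1}"
      have "norm (\<Sum>n<N. of_real (K t) * (c n * (of_real t * w) ^ n))
          \<le> (\<Sum>n<N. norm (of_real (K t) * (c n * (of_real t * w) ^ n)))"
        by (rule norm_sum)
      also have "\<dots> \<le> (\<Sum>n<N. K t * norm (c n * w ^ n))"
      proof (rule sum_mono)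
        fix n
        have "t ^ n \<le> 1" using t by (simp add: power_le_one)
        then have "K t * norm (c n * w ^ n) * t ^ n \<le> K t * norm (c n * w ^ n)"
          using K t by (intro mult_right_le_one_le) auto
        then show "norm (of_real (K t) * (c n * (of_real t * w) ^ n)) \<le> K t * norm (c n * w ^ n)"
          using K t by (simp add: norm_mult norm_power power_mult_distrib mult_ac)
      qed
      also have "\<dots> = K t * (\<Sum>n<N. norm (c n * w ^ n))" by (simp add: sum_distrib_left)
      also have "\<dots> \<le> K t * M"
        unfolding M_def by (intro mult_left_mono sum_le_suminf abs K) auto
      finally show "norm (\<Sum>n<N. of_real (K t) * (c n * (of_real t * w) ^ n)) \<le> K t * M" .
    qed
    show "\<forall>t\<in>{0..1}. (\<lambda>N. \<Sum>n<N. of_real (K t) * (c n * (of_real t * w) ^ n))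
            \<longlonglongrightarrow> of_real (K t) * f (of_real t * w)"
    proof
      fix t :: real assume t: "t \<in> {0..1}"
      then have "norm (of_real t * w) \<le> norm w" by (auto simp: norm_mult intro!: mult_left_le_one_le)
      with w have "norm (of_real t * w) < 1" by linarith
      from sums_mult[OF sums[OF this], of "of_real (K t)"]
      show "(\<lambda>N. \<Sum>n<N. of_real (K t) * (c n * (of_real t * w) ^ n))
            \<longlonglongrightarrow> of_real (K t) * f (of_real t * w)"
        by (simp add: sums_def)
    qed
    show "(\<lambda>N. \<Sum>n<N. c n * of_real (Beta (p + real n) q) * w ^ n) \<longlonglongrightarrow>
            (\<Sum>n. c n * of_real (Beta (p + real n) q) * w ^ n)"
      by (rule summable_LIMSEQ) (rule summable_Beta_powser[OF sm w p q])
  qed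
  then show ?thesis by (simp add: K_def)
qed

section \<open>The Tremblay operator on power series\<close>

text \<open>The substitution zeta = t w turns the segment integral into a Beta integral over [0, 1]
  with parameters \<tau> and 1 - \<sigma>, and all powers of \<open>w\<close> come out in
  front.\<close>

lemma contour_integral_frac_kernel:
  fixes c :: "nat \<Rightarrow> complex" and \<tau> \<sigma> :: real
  assumes sums: "\<And>z. norm z < 1 \<Longrightarrow> (\<lambda>n. c n * z ^ n) sums f z"
    and w: "norm w < 1" and w0: "w \<noteq> 0" and \<tau>: "0 < \<tau>" and \<sigma>: "\<sigma> < 1"
  shows "contour_integral (linepath 0 w)
            (\<lambda>\<zeta>. \<zeta> powr (of_real \<tau> - 1) * f \<zeta> * (w - \<zeta>) powr (- of_real \<sigma>)) =
         w powr of_real (\<tau> - \<sigma>) * (\<Sum>n. c n * of_real (Beta (\<tau> + real n) (1 - \<sigma>)) * w ^ n)"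
    (is "contour_integral _ ?g = _ * ?H")
proof (rule contour_integral_unique)
  have "((\<lambda>t. of_real (t powr (\<tau> - 1) * (1 - t) powr ((1 - \<sigma>) - 1)) * f (of_real t * w))
          has_integral ?H) {0..1}"
    using \<tau> \<sigma> by (intro has_integral_Beta_powser[OF sums w]) auto
  then have I: "((\<lambda>t. w powr of_real (\<tau> - \<sigma>) *
      (of_real (t powr (\<tau> - 1) * (1 - t) powr ((1 - \<sigma>) - 1)) * f (of_real t * w)))
          has_integral w powr of_real (\<tau> - \<sigma>) * ?H) {0..1}"
    by (rule has_integral_mult_right)
  have "((\<lambda>t. ?g (linepath 0 w t) * (w - 0)) has_integral w powr of_real (\<tau> - \<sigma>) * ?H) {0..1}"
  proof (rule has_integral_eq[OF _ I])
    fix t :: real assume t: "t \<in> {0..1}"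
    \<comment> \<open>A nonnegative real factor splits off a principal power without a branch
      correction; this applies to both t and 1 - t.\<close>
    have 1: "(of_real t * w) powr (of_real \<tau> - 1) = of_real (t powr (\<tau> - 1)) * w powr (of_real \<tau> - 1)"
      using t powr_of_real[of t "\<tau> - 1"] by (simp add: powr_times_real_left)
    have "w - of_real t * w = of_real (1 - t) * w" by (simp add: algebra_simps)
    then have 2: "(w - of_real t * w) powr (- of_real \<sigma>) = of_real ((1 - t) powr (- \<sigma>)) * w powr (- of_real \<sigma>)"
      using t powr_of_real[of "1 - t" "- \<sigma>"] by (simp only: powr_times_real_left) (simp add: powr_times_real_left)
    \<comment> \<open>The summand 1 in the exponent is the Jacobian d zeta = w dt.\<close>
    have "of_real (\<tau> - \<sigma>) = (of_real \<tau> - 1) + (- of_real \<sigma>) + (1 :: complex)" by simp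
    then have 3: "w powr of_real (\<tau> - \<sigma>) = w powr (of_real \<tau> - 1) * w powr (- of_real \<sigma>) * w"
      using w0 by (simp only: powr_add powr_one_eq_one) (simp add: powr_def)
    show "w powr of_real (\<tau> - \<sigma>) *
      (of_real (t powr (\<tau> - 1) * (1 - t) powr ((1 - \<sigma>) - 1)) * f (of_real t * w)) =
      ?g (linepath 0 w t) * (w - 0)"
      unfolding 3 linepath_def by (simp add: scaleR_conv_of_real 1 2)
  qed
  then show "(?g has_contour_integral w powr of_real (\<tau> - \<sigma>) * ?H) (linepath 0 w)"
    by (simp only: has_contour_integral_linepath)
qed

text \<open>With \<sigma> = \<tau> - \<mu> the integral is w^\<mu> H(w). Its derivative, multiplied
  by z^(1 - \<mu>), loses every fractional power and becomes \<mu> H + z H', which is again a power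
  series. Off the branch cut the principal power can be differentiated.\<close>

lemma tremblay_formula_powser:
  fixes c :: "nat \<Rightarrow> complex" and \<tau> \<mu> :: real
  assumes sums: "\<And>z. norm z < 1 \<Longrightarrow> (\<lambda>n. c n * z ^ n) sums f z"
    and z: "norm z < 1" "z \<notin> \<real>\<^sub>\<le>\<^sub>0" and \<tau>: "0 < \<tau>" and \<mu>: "0 < \<mu>" and "\<tau> - \<mu> < 1"
  shows "(\<lambda>n. of_real (Gamma \<mu> / Gamma \<tau> * (Gamma (\<tau> + real n) / Gamma (\<mu> + real n))) * c n * z ^ n)
           sums tremblay_formula \<tau> \<mu> f z"
proof -
  define \<sigma> where "\<sigma> = \<tau> - \<mu>"
  have \<sigma>: "\<sigma> < 1" using assms by (simp add: \<sigma>_def)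
  define b where "b n = c n * of_real (Beta (\<tau> + real n) (1 - \<sigma>))" for n
  define H where "H w = (\<Sum>n. b n * w ^ n)" for w
  have H: "(\<lambda>n. b n * w ^ n) sums H w" if "norm w < 1" for w
    unfolding H_def b_def
    by (intro summable_sums summable_Beta_powser that \<tau> sums_summable[OF sums]) (use \<sigma> in auto)
  have z0: "z \<noteq> 0" using z by auto
  \<comment> \<open>The closed form holds on the whole punctured disk, an open neighbourhood of
    \<open>z\<close>, so the outer derivative may be taken of it instead.\<close>
  have ev: "eventually (\<lambda>w. contour_integral (linepath 0 w)
            (\<lambda>\<zeta>. \<zeta> powr (of_real \<tau> - 1) * f \<zeta> * (w - \<zeta>) powr (- of_real \<sigma>)) =
             w powr of_real \<mu> * H w) (nhds z)"
  proof (rule eventually_mono)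
    show "eventually (\<lambda>w. w \<in> ball 0 1 - {0}) (nhds z)"
      using z z0 by (intro eventually_nhds_in_open) auto
    show "contour_integral (linepath 0 w)
            (\<lambda>\<zeta>. \<zeta> powr (of_real \<tau> - 1) * f \<zeta> * (w - \<zeta>) powr (- of_real \<sigma>)) =
             w powr of_real \<mu> * H w" if "w \<in> ball 0 1 - {0}" for w
      unfolding H_def b_def using that contour_integral_frac_kernel[OF sums, of w \<tau> \<sigma>] \<tau> \<sigma>
      by (simp add: \<sigma>_def)
  qed
  have "((\<lambda>w. w powr of_real \<mu> * H w) has_field_derivative
          of_real \<mu> * z powr (of_real \<mu> - 1) * H z + z powr of_real \<mu> * deriv H z) (at z)"
    using DERIV_mult[OF has_field_derivative_powr[OF z(2)] powser_has_field_derivative(1)[OF H z(1)]]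
    by (simp only: mult.commute[of "deriv H z"])
  then have D: "deriv (\<lambda>w. contour_integral (linepath 0 w)
            (\<lambda>\<zeta>. \<zeta> powr (of_real \<tau> - 1) * f \<zeta> * (w - \<zeta>) powr (- of_real \<sigma>))) z =
          of_real \<mu> * z powr (of_real \<mu> - 1) * H z + z powr of_real \<mu> * deriv H z"
    by (subst deriv_cong_ev[OF ev refl]) (rule DERIV_imp_deriv)
  have "z powr ((1 - of_real \<mu>) + (of_real \<mu> - 1)) = 1" using z0 by simp
  then have p1: "z powr (1 - of_real \<mu>) * z powr (of_real \<mu> - 1) = 1"
    by (simp only: powr_add)
  have "z powr ((1 - of_real \<mu>) + of_real \<mu>) = z" using z0 by (simp add: powr_def)
  then have p2: "z powr (1 - of_real \<mu>) * z powr of_real \<mu> = z"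
    by (simp only: powr_add)
  define A where "A = complex_of_real (Gamma \<mu> / Gamma \<tau>) * (1 / of_real (Gamma (1 - \<sigma>)))"
  have T: "tremblay_formula \<tau> \<mu> f z = A * (of_real \<mu> * H z + z * deriv H z)"
  proof -
    have "tremblay_formula \<tau> \<mu> f z = A * (z powr (1 - of_real \<mu>) *
            (of_real \<mu> * z powr (of_real \<mu> - 1) * H z + z powr of_real \<mu> * deriv H z))"
      unfolding tremblay_formula_def frac_deriv_def A_def D[folded \<sigma>_def] \<sigma>_def[symmetric] by (simp only: mult_ac)
    also have "z powr (1 - of_real \<mu>) *
            (of_real \<mu> * z powr (of_real \<mu> - 1) * H z + z powr of_real \<mu> * deriv H z) =
        of_real \<mu> * (z powr (1 - of_real \<mu>) * z powr (of_real \<mu> - 1)) * H z +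
        (z powr (1 - of_real \<mu>) * z powr of_real \<mu>) * deriv H z"
      by (simp only: algebra_simps)
    finally show ?thesis unfolding p1 p2 by simp
  qed
  have S: "(\<lambda>n. A * (of_real \<mu> * (b n * z ^ n) + of_nat n * b n * z ^ n)) sums tremblay_formula \<tau> \<mu> f z"
    unfolding T by (intro sums_mult sums_add H z powser_has_field_derivative(2)[OF H z(1)])
  have "A * (of_real \<mu> * (b n * z ^ n) + of_nat n * b n * z ^ n) =
     of_real (Gamma \<mu> / Gamma \<tau> * (Gamma (\<tau> + real n) / Gamma (\<mu> + real n))) * c n * z ^ n" for n
  proof -
    \<comment> \<open>The operator \<mu> H + z H' contributes the factor \<mu> + n. It cancels
      against Gamma(\<mu> + n + 1) = (\<mu> + n) Gamma(\<mu> + n), the denominator of the Beta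
      value, and leaves the plain Gamma quotient.\<close>
    have m: "\<mu> + real n > 0" using \<mu> by simp
    then have "\<mu> + real n \<notin> \<int>\<^sub>\<le>\<^sub>0" by (auto elim!: nonpos_Ints_cases)
    then have G: "Gamma (\<mu> + real n + 1) = (\<mu> + real n) * Gamma (\<mu> + real n)"
      by (rule Gamma_plus1)
    have "(\<mu> + real n) * Beta (\<tau> + real n) (1 - \<sigma>) / Gamma (1 - \<sigma>) = Gamma (\<tau> + real n) / Gamma (\<mu> + real n)"
    proof -
      have "\<tau> + real n + (1 - \<sigma>) = \<mu> + real n + 1" by (simp add: \<sigma>_def)
      then have "Beta (\<tau> + real n) (1 - \<sigma>) =
          Gamma (\<tau> + real n) * Gamma (1 - \<sigma>) / ((\<mu> + real n) * Gamma (\<mu> + real n))"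
        by (simp only: Beta_def G)
      moreover have "m * (x * s / (m * y)) / s = x / y" if "m > 0" "s > 0" for m s x y :: real
        using that by simp
      ultimately show ?thesis
        using m \<sigma> by (simp only: Gamma_real_pos diff_gt_0_iff_gt)
    qed
    then have "complex_of_real (Gamma (\<tau> + real n) / Gamma (\<mu> + real n)) =
       of_real (\<mu> + real n) * of_real (Beta (\<tau> + real n) (1 - \<sigma>)) / of_real (Gamma (1 - \<sigma>))"
      by (metis of_real_divide of_real_mult)
    then have "of_real (Gamma \<mu> / Gamma \<tau> * (Gamma (\<tau> + real n) / Gamma (\<mu> + real n))) * c n * z ^ n
      = complex_of_real (Gamma \<mu> / Gamma \<tau>) * (of_real (\<mu> + real n) * of_real (Beta (\<tau> + real n) (1 - \<sigma>)) / of_real (Gamma (1 - \<sigma>))) * c n * z ^ n"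
      by (simp only: of_real_mult)
    also have "\<dots> = A * (of_real \<mu> * (b n * z ^ n) + of_nat n * b n * z ^ n)"
      by (simp add: A_def b_def algebra_simps add_divide_distrib)
    finally show ?thesis ..
  qed
  with S show ?thesis by simp
qed

text \<open>The formula fixes the operator only on the slit disk. The sum \<open>F\<close> of the
  series is holomorphic on the full disk and agrees with the formula there, so a function as
  described by \<open>SOME\<close> exists; the identity theorem then equates the chosen one with
  \<open>F\<close>.\<close>

lemma tremblay_powser:
  fixes c :: "nat \<Rightarrow> complex" and \<tau> \<mu> :: real
  assumes sums: "\<And>z. norm z < 1 \<Longrightarrow> (\<lambda>n. c n * z ^ n) sums f z"
    and \<tau>: "0 < \<tau>" and \<mu>: "0 < \<mu>" and \<sigma>: "\<tau> - \<mu> < 1" and z: "norm z < 1"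
  shows "(\<lambda>n. of_real (Gamma \<mu> / Gamma \<tau> * (Gamma (\<tau> + real n) / Gamma (\<mu> + real n))) * c n * z ^ n)
           sums tremblay \<tau> \<mu> f z"
proof -
  define d where "d n = of_real (Gamma \<mu> / Gamma \<tau> * (Gamma (\<tau> + real n) / Gamma (\<mu> + real n))) * c n" for n
  define F where "F w = (\<Sum>n. d n * w ^ n)" for w
  let ?S = "ball 0 1 - \<real>\<^sub>\<le>\<^sub>0 :: complex set"
  have d: "(\<lambda>n. d n * w ^ n) sums tremblay_formula \<tau> \<mu> f w" if "norm w < 1" "w \<notin> \<real>\<^sub>\<le>\<^sub>0" for w
    unfolding d_def by (rule tremblay_formula_powser[OF sums that \<tau> \<mu> \<sigma>])
  have F: "(\<lambda>n. d n * w ^ n) sums F w" if w: "norm w < 1" for w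
  proof -
    \<comment> \<open>Zero and the negative axis are reached through a positive real radius: r lies
      in the slit disk, where convergence is known, and has larger modulus than
      \<open>w\<close>.\<close>
    obtain r where r: "norm w < r" "r < 1" using dense[OF w] by blast
    then have "r > 0" using norm_ge_zero[of w] by linarith
    then have "summable (\<lambda>n. d n * of_real r ^ n)"
      using r by (intro sums_summable[OF d]) auto
    then have "summable (\<lambda>n. d n * w ^ n)"
      by (rule powser_inside) (use r \<open>r > 0\<close> in simp)
    then show ?thesis unfolding F_def by (rule summable_sums)
  qed
  have F_holo: "F holomorphic_on ball 0 1" by (rule powser_holomorphic[OF F])
  have F_eq: "F w = tremblay_formula \<tau> \<mu> f w" if "w \<in> ?S" for w
    using sums_unique2[OF F d] that by auto
  have "\<exists>F. F holomorphic_on ball 0 1 \<and> (\<forall>z\<in>?S. F z = tremblay_formula \<tau> \<mu> f z)"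
    using F_holo F_eq by blast
  from someI_ex[OF this]
  have T: "tremblay \<tau> \<mu> f holomorphic_on ball 0 1"
      "\<And>z. z \<in> ?S \<Longrightarrow> tremblay \<tau> \<mu> f z = tremblay_formula \<tau> \<mu> f z"
    unfolding tremblay_def by blast+
  have "1 / 2 \<in> ?S" by (auto simp: complex_nonpos_Reals_iff)
  then have "?S \<noteq> {}" by blast
  have "F z = tremblay \<tau> \<mu> f z"
  proof (rule analytic_continuation_open[of ?S "ball 0 1" F "tremblay \<tau> \<mu> f"])
    show "open ?S" by (intro open_Diff open_ball closed_nonpos_Reals_complex)
    show "connected (ball 0 1 :: complex set)" by (rule connected_ball)
    show "F w = tremblay \<tau> \<mu> f w" if "w \<in> ?S" for w
      using F_eq[OF that] T(2)[OF that] by simp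
  qed (use \<open>?S \<noteq> {}\<close> F_holo T(1) z in auto)
  with F[OF z] show ?thesis by (simp add: d_def)
qed

section \<open>The coefficient inequality of the class\<close>

text \<open>\<open>L n\<close> is the factor by which the class expression, multiplied by z, scales
  the n-th coefficient. That expression is thus z minus the sum of the a_n L_n z^n. At z = r in (0,
  1) all terms of this sum are nonnegative, so the lower bound on the real part becomes an upper
  bound on the sum.\<close>

lemma coefficient_bound:
  fixes a :: "nat \<Rightarrow> real" and \<tau> \<mu> \<delta> \<gamma> :: real
  defines "L \<equiv> \<lambda>n. (1 + \<delta> * real n - \<delta>) * Gamma (real n + \<tau>) * Gamma (\<mu> + 1) /
                   (Gamma (real n + \<mu>) * Gamma (\<tau> + 1))"
  assumes a: "\<And>n. a n \<ge> 0" "a 0 = 0" "a 1 = 0"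
    and f: "\<And>z. norm z < 1 \<Longrightarrow> (\<lambda>n. of_real (a n) * z ^ n) sums (z - f z)"
    and par: "0 < \<tau>" "0 < \<mu>" "\<tau> - \<mu> < 1" "0 \<le> \<delta>"
    and re: "\<And>z. z \<in> ball 0 1 \<Longrightarrow> Re (remove_sings
          (\<lambda>w. of_real (Gamma (\<mu> + 1) * Gamma \<tau> / (Gamma (\<tau> + 1) * Gamma \<mu>)) * inverse w *
               (of_real (1 - \<delta>) * tremblay \<tau> \<mu> f w
                + of_real \<delta> * w * deriv (tremblay \<tau> \<mu> f) w)) z) > \<gamma>"
  shows "summable (\<lambda>n. a n * L n)" and "(\<Sum>n. a n * L n) \<le> 1 - \<gamma>"
proof -
  define c where "c n = (if n = 1 then 1 else 0) - complex_of_real (a n)" for n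
  define T where "T = tremblay \<tau> \<mu> f"
  define C where "C = Gamma (\<mu> + 1) * Gamma \<tau> / (Gamma (\<tau> + 1) * Gamma \<mu>)"
  define d where "d n = of_real (Gamma \<mu> / Gamma \<tau> * (Gamma (\<tau> + real n) / Gamma (\<mu> + real n))) * c n" for n
  have Gpos: "Gamma \<mu> > 0" "Gamma \<tau> > 0" "Gamma (\<mu> + 1) > 0" "Gamma (\<tau> + 1) > 0"
      "Gamma (real n + \<mu>) > 0" "Gamma (real n + \<tau>) > 0" for n
    using par by (simp_all add: Gamma_real_pos add_nonneg_pos)
  have id_sums: "(\<lambda>n. (if n = 1 then 1 else 0) * z ^ n) sums z" for z :: complex
    using sums_single[of 1 "\<lambda>n. z ^ n"] by (simp add: if_distrib if_distribR cong: if_cong)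
  have fc: "(\<lambda>n. c n * z ^ n) sums f z" if "norm z < 1" for z
    using sums_diff[OF id_sums[of z] f[OF that]] by (simp add: c_def left_diff_distrib)
  have Td: "(\<lambda>n. d n * z ^ n) sums T z" if "norm z < 1" for z
    unfolding T_def d_def using tremblay_powser[OF fc par(1-3) that] .
  have T_holo: "T holomorphic_on ball 0 1" by (rule powser_holomorphic[OF Td])
  then have T_an: "T analytic_on {z}" "deriv T analytic_on {z}" if "norm z < 1" for z
    using that by (auto simp: analytic_on_open[symmetric] intro!: analytic_on_subset[of _ "ball 0 1"] analytic_deriv)
  have L_nonneg: "L n \<ge> 0" if "n \<ge> 1" for n
  proof -
    have "\<delta> * 1 \<le> \<delta> * real n" using that par by (intro mult_left_mono) auto
    then show ?thesis unfolding L_def using Gpos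
      by (intro divide_nonneg_nonneg mult_nonneg_nonneg) (auto simp: less_imp_le)
  qed
  \<comment> \<open>The sign of \<open>L 0\<close> is not controlled, but
    \<open>a 0 = 0\<close>.\<close>
  have nonneg: "a n * L n \<ge> 0" for n
    using a L_nonneg[of n] by (cases "n = 0") (auto intro!: mult_nonneg_nonneg)
  have key: "(\<Sum>n<N. a n * L n * r ^ n) \<le> r * (1 - \<gamma>)" if r: "0 < r" "r < 1" for r N
  proof -
    let ?z = "complex_of_real r"
    define E where "E = of_real C * inverse ?z * (of_real (1 - \<delta>) * T ?z + of_real \<delta> * ?z * deriv T ?z)"
    have nz: "norm ?z < 1" "?z \<noteq> 0" using r by auto
    \<comment> \<open>At a nonzero point the expression is analytic, so \<open>remove_sings\<close>
      keeps its value and the class condition speaks about \<open>E\<close> itself.\<close>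
    have "(\<lambda>w. of_real C * inverse w * (of_real (1 - \<delta>) * T w + of_real \<delta> * w * deriv T w)) analytic_on {?z}"
      using nz by (intro analytic_intros T_an) auto
    then have "Re E > \<gamma>"
      using re[of ?z] nz unfolding E_def C_def T_def by simp
    moreover have "(\<lambda>n. of_real C * (of_real (1 - \<delta>) * (d n * ?z ^ n) + of_real \<delta> * (of_nat n * d n * ?z ^ n)))
        sums (of_real C * (of_real (1 - \<delta>) * T ?z + of_real \<delta> * (?z * deriv T ?z)))"
      by (intro sums_mult sums_add Td nz powser_has_field_derivative(2)[OF Td nz(1)])
    moreover have "of_real C * (of_real (1 - \<delta>) * T ?z + of_real \<delta> * (?z * deriv T ?z)) = ?z * E"
      using nz by (simp add: E_def field_simps)
    moreover have "of_real C * (of_real (1 - \<delta>) * (d n * ?z ^ n) + of_real \<delta> * (of_nat n * d n * ?z ^ n))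
        = of_real (L n) * c n * ?z ^ n" for n
    proof -
      have "L n = C * (1 - \<delta> + \<delta> * real n) * (Gamma \<mu> / Gamma \<tau> * (Gamma (\<tau> + real n) / Gamma (\<mu> + real n)))"
      proof -
        have "l * x * m / (y * t) = m * g\<^sub>\<tau> / (t * g\<^sub>\<mu>) * l * (g\<^sub>\<mu> / g\<^sub>\<tau> * (x / y))"
          if "g\<^sub>\<tau> > 0" "g\<^sub>\<mu> > 0" for l x m y t g\<^sub>\<tau> g\<^sub>\<mu> :: real
          using that by (simp add: mult_ac)
        from this[OF Gpos(2,1)] show ?thesis
          by (simp only: L_def C_def add.commute[of \<tau>] add.commute[of \<mu>] diff_add_eq)
      qed
      then have "complex_of_real (L n) = of_real C * of_real (1 - \<delta> + \<delta> * real n) *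
          of_real (Gamma \<mu> / Gamma \<tau> * (Gamma (\<tau> + real n) / Gamma (\<mu> + real n)))"
        by (simp only: of_real_mult)
      moreover have "complex_of_real (1 - \<delta> + \<delta> * real n) = of_real (1 - \<delta>) + of_real \<delta> * of_nat n"
        by simp
      moreover have "C' * (x * ((y * s) * u) + v * (k * (y * s) * u)) = C' * (x + v * k) * y * s * u"
        for C' x y s u v k :: complex
        by (simp add: algebra_simps)
      ultimately show ?thesis unfolding d_def by (simp only:)
    qed
    ultimately have E: "Re E > \<gamma>" "(\<lambda>n. of_real (L n) * c n * ?z ^ n) sums (?z * E)"
      by simp_all
    \<comment> \<open>The constant \<open>C\<close> is the reciprocal of the Tremblay factor at n =
      1. Hence the linear term is exactly z, and subtracting the series from z leaves only the terms
      in \<open>a\<close>.\<close>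
    have "L 1 = 1" using Gpos by (simp add: L_def add.commute)
    then have "of_real (L n) * c n * ?z ^ n = (if n = 1 then 1 else 0) * ?z ^ n - of_real (a n * L n * r ^ n)" for n
      by (simp add: c_def algebra_simps)
    with E(2) have "(\<lambda>n. (if n = 1 then 1 else 0) * ?z ^ n - of_real (a n * L n * r ^ n)) sums (?z * E)"
      by simp
    from sums_diff[OF id_sums[of ?z] this]
    have "(\<lambda>n. of_real (a n * L n * r ^ n)) sums (?z - ?z * E)" by simp
    from sums_Re[OF this] have S: "(\<lambda>n. a n * L n * r ^ n) sums (r * (1 - Re E))"
      by (simp add: right_diff_distrib del: of_real_mult of_real_power)
    have "(\<Sum>n<N. a n * L n * r ^ n) \<le> (\<Sum>n. a n * L n * r ^ n)"
      using r by (intro sum_le_suminf sums_summable[OF S] mult_nonneg_nonneg[OF nonneg]) auto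
    also have "\<dots> = r * (1 - Re E)" using S by (rule sums_unique[symmetric])
    also have "\<dots> \<le> r * (1 - \<gamma>)" using E(1) r by (intro mult_left_mono) auto
    finally show ?thesis .
  qed
  \<comment> \<open>Finite partial sums are polynomials in r, so r can tend to 1 without any prior
    knowledge of convergence at 1; summability then follows from the uniform bound.\<close>
  have bound: "(\<Sum>n<N. a n * L n) \<le> 1 - \<gamma>" for N
  proof (rule tendsto_le[of "at_left (1::real)"])
    show "((\<lambda>r. r * (1 - \<gamma>)) \<longlongrightarrow> 1 - \<gamma>) (at_left 1)"
      by (auto intro!: tendsto_eq_intros)
    show "((\<lambda>r. \<Sum>n<N. a n * L n * r ^ n) \<longlongrightarrow> (\<Sum>n<N. a n * L n)) (at_left 1)"
      by (auto intro!: tendsto_eq_intros)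
    have "eventually (\<lambda>r. r \<in> {0<..<1::real}) (at_left 1)"
      by (rule eventually_at_leftI[of 0]) auto
    then show "eventually (\<lambda>r. (\<Sum>n<N. a n * L n * r ^ n) \<le> r * (1 - \<gamma>)) (at_left (1::real))"
      by eventually_elim (use key in auto)
  qed simp
  show "summable (\<lambda>n. a n * L n)"
    using nonneg bound by (rule summableI_nonneg_bounded)
  then show "(\<Sum>n. a n * L n) \<le> 1 - \<gamma>"
    using bound by (rule suminf_le_const)
qed

section \<open>A coefficient criterion for starlikeness\<close>

text \<open>Let A and B be the sums of a_n |z|^n and n a_n |z|^n. Then |f - z f'| is at most B - A
  and |f| is at least |z| - A. The hypothesis B - \<alpha> A < (1 - \<alpha>) |z| says precisely B -
  A < (1 - \<alpha>) (|z| - A), which places z f' / f within distance less than 1 - \<alpha> of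
  1.\<close>

lemma starlike_criterion:
  fixes a :: "nat \<Rightarrow> real" and \<alpha> :: real
  assumes a: "\<And>n. a n \<ge> 0" "a 0 = 0"
    and f: "\<And>z. norm z < 1 \<Longrightarrow> (\<lambda>n. of_real (a n) * z ^ n) sums (z - f z)"
    and \<alpha>: "\<alpha> < 1"
    and z: "norm z < 1"
    and less: "(\<Sum>n. (real n - \<alpha>) * a n * norm z ^ n) < (1 - \<alpha>) * norm z"
  shows "Re (z * deriv f z / f z) > \<alpha>"
proof -
  let ?g = "\<lambda>z. z - f z"
  have g: "(\<lambda>n. of_nat n * of_real (a n) * z ^ n) sums (z * deriv ?g z)"
    and gd: "(?g has_field_derivative deriv ?g z) (at z)"
    using powser_has_field_derivative[OF f z] by blast+
  have "((\<lambda>z. z - ?g z) has_field_derivative (1 - deriv ?g z)) (at z)"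
    by (intro derivative_intros gd)
  then have df: "deriv f z = 1 - deriv ?g z" by (simp add: DERIV_imp_deriv)
  have diff: "(\<lambda>n. of_real ((real n - 1) * a n) * z ^ n) sums (f z - z * deriv f z)"
    using sums_diff[OF g f[OF z]] by (simp add: df algebra_simps)
  have norm_a: "summable (\<lambda>n. a n * norm z ^ n)"
    using powser_abs_summable[OF sums_summable[OF f] z] a by (simp add: norm_mult norm_power)
  have "summable (\<lambda>n. of_nat n * complex_of_real (a n) * z ^ n)" if "norm z < 1" for z
    using powser_has_field_derivative(2)[OF f that] by (rule sums_summable)
  from powser_abs_summable[OF this z]
  have norm_na: "summable (\<lambda>n. real n * (a n * norm z ^ n))"
    using a by (simp add: norm_mult norm_power mult_ac)
  define A where "A = (\<Sum>n. a n * norm z ^ n)"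
  define B where "B = (\<Sum>n. real n * (a n * norm z ^ n))"
  have A: "(\<lambda>n. a n * norm z ^ n) sums A" and B: "(\<lambda>n. real n * (a n * norm z ^ n)) sums B"
    unfolding A_def B_def using norm_a norm_na by (simp_all add: summable_sums)
  \<comment> \<open>Needed for \<beta> = \<alpha> in the hypothesis and for \<beta> = 1 in the bound
    on f - z f'.\<close>
  have BA: "(\<lambda>n. (real n - \<beta>) * a n * norm z ^ n) sums (B - \<beta> * A)" for \<beta>
    using sums_diff[OF B sums_mult[OF A, of \<beta>]] by (simp add: algebra_simps)
  have less': "B - \<alpha> * A < (1 - \<alpha>) * norm z"
    using less sums_unique[OF BA] by simp
  \<comment> \<open>The factor n - 1 is negative only at \<open>n = 0\<close>, where
    \<open>a 0 = 0\<close>.\<close>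
  have eq: "norm (of_real ((real n - 1) * a n) * z ^ n) = (real n - 1) * a n * norm z ^ n" for n
    using a by (cases n) (simp_all add: norm_mult norm_power)
  have "norm (f z - z * deriv f z) \<le> B - 1 * A"
  proof -
    have "norm (\<Sum>n. of_real ((real n - 1) * a n) * z ^ n) \<le> (\<Sum>n. norm (of_real ((real n - 1) * a n) * z ^ n))"
      by (rule summable_norm) (unfold eq, rule sums_summable[OF BA])
    then show ?thesis unfolding eq using sums_unique[OF BA[of 1]] sums_unique[OF diff] by simp
  qed
  moreover have "norm z - A \<le> norm (f z)"
  proof -
    have "norm (\<Sum>n. of_real (a n) * z ^ n) \<le> (\<Sum>n. norm (of_real (a n) * z ^ n))"
      by (rule summable_norm) (rule powser_abs_summable[OF sums_summable[OF f] z])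
    then have "norm (z - f z) \<le> A"
      using a by (simp add: norm_mult norm_power A_def sums_unique[OF f[OF z]])
    then show ?thesis using norm_triangle_ineq2[of z "z - f z"] by simp
  qed
  then have "(1 - \<alpha>) * (norm z - A) \<le> (1 - \<alpha>) * norm (f z)"
    using \<alpha> by (intro mult_left_mono) auto
  ultimately have *: "norm (f z - z * deriv f z) < (1 - \<alpha>) * norm (f z)"
    using less' by (simp add: algebra_simps)
  \<comment> \<open>If f(z) were 0, the strict inequality would put a norm below 0.\<close>
  then have f0: "f z \<noteq> 0" by auto
  then have "norm (1 - z * deriv f z / f z) = norm (f z - z * deriv f z) / norm (f z)"
    by (simp add: norm_divide[symmetric] diff_divide_distrib)
  also have "\<dots> < 1 - \<alpha>" using * f0 by (simp add: divide_less_eq)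
  finally show ?thesis using complex_Re_le_cmod[of "1 - z * deriv f z / f z"] by simp
qed

section \<open>The radius of starlikeness\<close>

text \<open>The infimum lies below each of its members, and raising to the power n - 1 undoes the
  root; n is at least 2 here, so the exponent 1 / (n - 1) is genuine. Zero is a lower bound of the
  family because \<open>powr\<close> is nonnegative.\<close>

lemma starlike_radius_power_le:
  fixes \<tau> \<mu> \<delta> \<gamma> \<alpha> :: real
  assumes "0 < \<tau>" "0 < \<mu>" "0 \<le> \<delta>" "\<gamma> < 1" "\<alpha> < 1" "k \<ge> 1" "n \<ge> k + 1"
    and "starlike_radius k \<tau> \<mu> \<delta> \<gamma> \<alpha> > 0"
  shows "starlike_radius k \<tau> \<mu> \<delta> \<gamma> \<alpha> ^ (n - 1) \<le>
     (1 - \<alpha>) * (1 + \<delta> * real n - \<delta>) * Gamma (real n + \<tau>) * Gamma (\<mu> + 1) /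
         ((real n - \<alpha>) * (1 - \<gamma>) * Gamma (real n + \<mu>) * Gamma (\<tau> + 1))"
    (is "?r ^ _ \<le> ?q n")
proof -
  have "?r \<le> ?q n powr (1 / (real n - 1))"
    unfolding starlike_radius_def using assms by (intro cINF_lower bdd_belowI2[of _ 0]) auto
  then have "?r ^ (n - 1) \<le> (?q n powr (1 / (real n - 1))) ^ (n - 1)"
    using assms by (intro power_mono) auto
  also have "\<dots> = ?q n"
  proof -
    have "\<delta> * 1 \<le> \<delta> * real n" using assms by (intro mult_left_mono) auto
    then have "?q n > 0" using assms
      by (intro divide_pos_pos mult_pos_pos Gamma_real_pos) auto
    moreover have "1 / (real n - 1) * real (n - 1) = 1"
      using assms by (auto simp: of_nat_diff)
    moreover have "(x powr y) ^ m = x" if "x > 0" "y * real m = 1" for x y :: real and m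
      using that by (simp add: powr_realpow[symmetric] powr_powr)
    ultimately show ?thesis by blast
  qed
  finally show ?thesis .
qed

text \<open>The Beta value at (\<tau> + n, 1 + \<mu> - \<tau>) has denominator Gamma(n + \<mu> + 1)
  and does not exceed its value at n = 0. Passing from Gamma(n + \<mu> + 1) to Gamma(n + \<mu>)
  costs the linear factor.\<close>

lemma Gamma_ratio_le:
  fixes \<tau> \<mu> :: real
  assumes "0 < \<tau>" "0 < \<mu>" "\<tau> - \<mu> < 1"
  shows "Gamma (real n + \<tau>) / Gamma (real n + \<mu>) \<le> (real n + \<mu>) * (Gamma \<tau> / Gamma (\<mu> + 1))"
proof -
  have pos: "real n + \<mu> > 0" "Gamma (real n + \<mu>) > 0" "Gamma (\<mu> + 1) > 0" "Gamma (1 + \<mu> - \<tau>) > 0"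
    using assms by (auto intro!: Gamma_real_pos)
  then have "real n + \<mu> \<notin> \<int>\<^sub>\<le>\<^sub>0" by (auto elim!: nonpos_Ints_cases)
  then have G: "Gamma (real n + \<mu> + 1) = (real n + \<mu>) * Gamma (real n + \<mu>)"
    by (rule Gamma_plus1)
  have "Beta (\<tau> + real n) (1 + \<mu> - \<tau>) \<le> Beta \<tau> (1 + \<mu> - \<tau>)"
    using assms by (intro Beta_add_nat_le) auto
  moreover have "\<tau> + real n + (1 + \<mu> - \<tau>) = real n + \<mu> + 1" "\<tau> + (1 + \<mu> - \<tau>) = \<mu> + 1" by auto
  ultimately have "Gamma (real n + \<tau>) / Gamma (real n + \<mu> + 1) \<le> Gamma \<tau> / Gamma (\<mu> + 1)"
    using pos by (simp add: Beta_def field_simps)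
  then have "Gamma (real n + \<tau>) / Gamma (real n + \<mu>) / (real n + \<mu>) \<le> Gamma \<tau> / Gamma (\<mu> + 1)"
    unfolding G by (simp add: mult.commute)
  then show ?thesis
    using pos by (simp add: divide_le_eq mult_ac)
qed

text \<open>A radius above 1 would make its powers grow geometrically below a quadratic bound. The
  result keeps the disk of the theorem inside the unit disk, where the series of \<open>f\<close> is
  available.\<close>

lemma starlike_radius_le_1:
  fixes \<tau> \<mu> \<delta> \<gamma> \<alpha> :: real
  assumes "0 < \<tau>" "0 < \<mu>" "\<mu> \<le> 1" "\<tau> - \<mu> < 1" "0 \<le> \<delta>" "\<delta> \<le> 1" "\<gamma> < 1" "\<alpha> < 1" "k \<ge> 1"
  shows "starlike_radius k \<tau> \<mu> \<delta> \<gamma> \<alpha> \<le> 1"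
proof (rule ccontr)
  let ?r = "starlike_radius k \<tau> \<mu> \<delta> \<gamma> \<alpha>"
  assume "\<not> ?r \<le> 1"
  then have r: "?r > 1" by simp
  \<comment> \<open>What remains after Gamma(\<mu> + 1) cancels between the bound of
    \<open>Gamma_ratio_le\<close> and the expression under the root.\<close>
  define C where "C = Gamma \<tau> / (Gamma (\<tau> + 1) * (1 - \<gamma>))"
  have pos: "Gamma \<tau> > 0" "Gamma (\<tau> + 1) > 0" "Gamma (\<mu> + 1) > 0"
    using assms by (auto intro!: Gamma_real_pos)
  have le: "?r ^ (n - 1) \<le> C * (real n * (real n + 1))" if n: "n \<ge> k + 1" for n
  proof -
    have Gn: "Gamma (real n + \<tau>) > 0" "Gamma (real n + \<mu>) > 0"
      using assms by (auto intro!: Gamma_real_pos)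
    have "?r ^ (n - 1) \<le> (1 - \<alpha>) * (1 + \<delta> * real n - \<delta>) * Gamma (real n + \<tau>) * Gamma (\<mu> + 1) /
         ((real n - \<alpha>) * (1 - \<gamma>) * Gamma (real n + \<mu>) * Gamma (\<tau> + 1))"
      using starlike_radius_power_le[of \<tau> \<mu> \<delta> \<gamma> \<alpha> k n] assms n r by simp
    also have "\<dots> = ((1 - \<alpha>) / (real n - \<alpha>)) * (1 + \<delta> * (real n - 1)) *
        (Gamma (real n + \<tau>) / Gamma (real n + \<mu>)) * (Gamma (\<mu> + 1) / ((1 - \<gamma>) * Gamma (\<tau> + 1)))"
      by (simp add: right_diff_distrib[of \<delta>] add_diff_eq mult_ac)
    also have "\<dots> \<le> 1 * real n * ((real n + 1) * (Gamma \<tau> / Gamma (\<mu> + 1))) * (Gamma (\<mu> + 1) / ((1 - \<gamma>) * Gamma (\<tau> + 1)))"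
    \<comment> \<open>The first factor is at most 1, the second at most n, and the Gamma quotient is
      linear in n, with \<mu> replaced by 1.\<close>
    proof (intro mult_right_mono mult_mono)
      show "(1 - \<alpha>) / (real n - \<alpha>) \<le> 1" using n assms by (simp add: divide_le_eq)
      have "\<delta> * (real n - 1) \<le> 1 * (real n - 1)"
        using assms n by (intro mult_right_mono) auto
      then show "1 + \<delta> * (real n - 1) \<le> real n" by simp
      have "Gamma (real n + \<tau>) / Gamma (real n + \<mu>) \<le> (real n + \<mu>) * (Gamma \<tau> / Gamma (\<mu> + 1))"
        using assms by (intro Gamma_ratio_le)
      also have "\<dots> \<le> (real n + 1) * (Gamma \<tau> / Gamma (\<mu> + 1))"
        using assms pos by (intro mult_right_mono) auto
      finally show "Gamma (real n + \<tau>) / Gamma (real n + \<mu>) \<le> (real n + 1) * (Gamma \<tau> / Gamma (\<mu> + 1))" .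
    qed (use n assms pos Gn in auto)
    also have "\<dots> = C * (real n * (real n + 1))"
    proof -
      have "1 * x * (y * (u / g)) * (g / (e * t)) = u / (t * e) * (x * y)" if "g > 0" for x y u g e t :: real
        using that by (simp add: mult_ac)
      from this[OF pos(3)] show ?thesis unfolding C_def .
    qed
    finally show ?thesis .
  qed
  have "(\<lambda>n. C * (real n * (real n + 1)) / ?r ^ (n - 1)) \<longlonglongrightarrow> 0"
    using r by real_asymp
  then have "eventually (\<lambda>n. C * (real n * (real n + 1)) / ?r ^ (n - 1) < 1) sequentially"
    by (rule order_tendstoD) simp
  then have "eventually (\<lambda>n. C * (real n * (real n + 1)) / ?r ^ (n - 1) < 1 \<and> n \<ge> k + 1) sequentially"
    using eventually_ge_at_top by (rule eventually_conj)
  then obtain n where "C * (real n * (real n + 1)) / ?r ^ (n - 1) < 1" "n \<ge> k + 1"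
    by (auto simp: eventually_sequentially)
  with le[of n] r show False by (simp add: divide_less_eq)
qed

theorem theorem4:
  fixes k :: nat and \<tau> \<mu> \<delta> \<gamma> \<alpha> :: real and f :: "complex \<Rightarrow> complex"
  assumes "k \<ge> 1"
    and "0 < \<tau>" and "\<tau> \<le> 1"
    and "0 < \<mu>" and "\<mu> \<le> 1"
    and "0 \<le> \<tau> - \<mu>" and "\<tau> - \<mu> < 1"
    and "0 \<le> \<delta>" and "\<delta> < 1"
    and "0 \<le> \<gamma>" and "\<gamma> < 1"
    and "\<tau> - \<mu> + \<gamma> < 1"
    and "0 \<le> \<alpha>" and "\<alpha> < 1"
    and "f \<in> class_P_tremblay \<tau> \<mu> k \<delta> \<gamma>"
  shows "starlike_of_order_in_disk \<alpha> (starlike_radius k \<tau> \<mu> \<delta> \<gamma> \<alpha>) f"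
proof -
  define r where "r = starlike_radius k \<tau> \<mu> \<delta> \<gamma> \<alpha>"
  define L where "L n = (1 + \<delta> * real n - \<delta>) * Gamma (real n + \<tau>) * Gamma (\<mu> + 1) /
                   (Gamma (real n + \<mu>) * Gamma (\<tau> + 1))" for n
  have "f \<in> class_P k"
    using assms(15) by (simp add: class_P_tremblay_def)
  then obtain b :: "nat \<Rightarrow> real" where b: "\<forall>n\<ge>k+1. b n \<ge> 0"
    "\<forall>z\<in>ball 0 1. summable (\<lambda>n. of_real (b (n + (k+1))) * z ^ (n + (k+1))) \<and>
        f z = z - (\<Sum>n. of_real (b (n + (k+1))) * z ^ (n + (k+1)))"
    unfolding class_P_def mem_Collect_eq by (elim conjE exE)
  \<comment> \<open>The class constrains \<open>b\<close> only from index k + 1 on; extension by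
    zero gives an unshifted series with nonnegative coefficients throughout.\<close>
  define a where "a n = (if n \<ge> k + 1 then b n else 0)" for n
  have a: "\<And>n. a n \<ge> 0" "a 0 = 0" "a 1 = 0" "\<And>n. n < k + 1 \<Longrightarrow> a n = 0"
    using b(1) \<open>k \<ge> 1\<close> by (auto simp: a_def)
  have f: "(\<lambda>n. of_real (a n) * z ^ n) sums (z - f z)" if z: "norm z < 1" for z
  proof -
    have "(\<lambda>n. of_real (b (n + (k+1))) * z ^ (n + (k+1))) sums (z - f z)"
      using bspec[OF b(2), of z] z by (simp add: sums_iff)
    then have "(\<lambda>n. of_real (a (n + (k+1))) * z ^ (n + (k+1))) sums (z - f z)"
      by (simp add: a_def)
    then show ?thesis
      by (subst (asm) sums_zero_iff_shift) (use a(4) in auto)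
  qed
  have re: "Re (remove_sings
          (\<lambda>w. of_real (Gamma (\<mu> + 1) * Gamma \<tau> / (Gamma (\<tau> + 1) * Gamma \<mu>)) * inverse w *
               (of_real (1 - \<delta>) * tremblay \<tau> \<mu> f w
                + of_real \<delta> * w * deriv (tremblay \<tau> \<mu> f) w)) z) > \<gamma>" if "z \<in> ball 0 1" for z
    using assms(15) that by (simp add: class_P_tremblay_def)
  have aL: "summable (\<lambda>n. a n * L n)" "(\<Sum>n. a n * L n) \<le> 1 - \<gamma>"
    using coefficient_bound[of a f \<tau> \<mu> \<delta> \<gamma>, OF a(1-3) f assms(2,4,7,8) re]
    by (simp_all only: L_def)
  have "Re (z * deriv f z / f z) > \<alpha>" if z: "norm z < r" "z \<noteq> 0" for z
  proof (rule starlike_criterion[OF a(1,2) f \<open>\<alpha> < 1\<close>])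
    have r1: "r \<le> 1" unfolding r_def using assms by (intro starlike_radius_le_1) auto
    then show z1: "norm z < 1" using z by linarith
    have r0: "r > 0" using z norm_ge_zero[of z] by linarith
    \<comment> \<open>Termwise comparison factor. The extra |z| / r < 1 supplies strictness, even if
      the coefficient inequality is an equality.\<close>
    define M where "M = (1 - \<alpha>) * norm z * (norm z / r) / (1 - \<gamma>)"
    have M: "M \<ge> 0" unfolding M_def using r0 assms by simp
    have le: "(real n - \<alpha>) * a n * norm z ^ n \<le> M * (a n * L n)" for n
    proof (cases "n \<ge> k + 1")
      case False
      then show ?thesis using a(4)[of n] by simp
    next
      case True
      \<comment> \<open>Since k is at least 1, n is at least 2: of the factors of |z|^n two are
        kept, one of them rewritten as (|z| / r) r, and only the remaining m are enlarged to
        r.\<close>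
      then obtain m where m: "n = Suc (Suc m)" using \<open>k \<ge> 1\<close> by (cases n; cases "n - 1") auto
      have n\<alpha>: "real n - \<alpha> > 0" using m \<open>\<alpha> < 1\<close> by simp
      have "r ^ (n - 1) \<le> (1 - \<alpha>) * L n / ((real n - \<alpha>) * (1 - \<gamma>))"
        using starlike_radius_power_le[of \<tau> \<mu> \<delta> \<gamma> \<alpha> k n] assms True r0
        by (simp add: r_def L_def mult_ac)
      then have rn: "(real n - \<alpha>) * r ^ (n - 1) \<le> (1 - \<alpha>) * L n / (1 - \<gamma>)"
        using n\<alpha> \<open>\<gamma> < 1\<close> by (simp add: pos_le_divide_eq mult_ac)
      have "norm z ^ n = norm z * norm z * norm z ^ m" by (simp add: m)
      also have "\<dots> \<le> norm z * norm z * r ^ m"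
        using z by (intro mult_left_mono power_mono) auto
      also have "\<dots> = norm z * (norm z / r) * r ^ (n - 1)"
        using r0 by (simp add: m)
      finally have "(real n - \<alpha>) * norm z ^ n \<le> (real n - \<alpha>) * (norm z * (norm z / r) * r ^ (n - 1))"
        using n\<alpha> by (intro mult_left_mono) auto
      also have "\<dots> = norm z * (norm z / r) * ((real n - \<alpha>) * r ^ (n - 1))" by (simp only: mult_ac)
      also have "\<dots> \<le> norm z * (norm z / r) * ((1 - \<alpha>) * L n / (1 - \<gamma>))"
        using rn r0 by (intro mult_left_mono) auto
      also have "\<dots> = M * L n" by (simp add: M_def)
      finally have "a n * ((real n - \<alpha>) * norm z ^ n) \<le> a n * (M * L n)"
        using a(1) by (rule mult_left_mono)
      then show ?thesis by (simp add: mult_ac)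
    qed
    have nonneg: "0 \<le> (real n - \<alpha>) * a n * norm z ^ n" for n
      using a(1)[of n] a(2) \<open>\<alpha> < 1\<close> by (cases n) auto
    have sM: "summable (\<lambda>n. M * (a n * L n))" using aL(1) by (rule summable_mult)
    have "(\<Sum>n. (real n - \<alpha>) * a n * norm z ^ n) \<le> (\<Sum>n. M * (a n * L n))"
      by (intro suminf_le le sM summable_comparison_test'[OF sM]) (use le nonneg in auto)
    also have "\<dots> = M * (\<Sum>n. a n * L n)" using aL(1) by (rule suminf_mult)
    also have "\<dots> \<le> M * (1 - \<gamma>)" using aL(2) M by (rule mult_left_mono)
    also have "\<dots> = (1 - \<alpha>) * norm z * (norm z / r)" using assms by (simp add: M_def)
    also have "\<dots> < (1 - \<alpha>) * norm z * 1"
      \<comment> \<open>Strictness uses both |z| < r and z different from 0.\<close>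
      using z r0 assms by (intro mult_strict_left_mono) auto
    finally show "(\<Sum>n. (real n - \<alpha>) * a n * norm z ^ n) < (1 - \<alpha>) * norm z" by simp
  qed
  \<comment> \<open>At z = 0 the quotient has the assigned value 1, which exceeds \<alpha>.\<close>
  then show ?thesis
    using \<open>\<alpha> < 1\<close> unfolding starlike_of_order_in_disk_def r_def by simp
qed

end
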